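(* Let $(B_n)_{n\ge0}$ be the balancing numbers, $B_0=0$, $B_1=1$, $B_n=6B_{n-1}-B_{n-2}$, and $(D_n)_{n\ge0}$ the double Lucas-balancing numbers, $D_0=2$, $D_1=6$, $D_n=6D_{n-1}-D_{n-2}$. Then for all $n\ge1$, $$\sum_{i=1}^n i B_i = \frac{1}{4} \bigl( n B_{n+1} - (n+1) B_{n} \bigr), \qquad \sum_{i=1}^n i D_i = \frac{1}{4} \bigl( n D_{n+1} - (n+1) D_{n} + 2 \bigr).$$ *)

theory Defs
  imports Complex_Main
begin

fun balancing :: "nat \<Rightarrow> int" where
  "balancing 0 = 0"
| "balancing (Suc 0) = 1"
| "balancing (Suc (Suc n)) = 6 * balancing (Suc n) - balancing n"

fun double_lucas_balancing :: "nat \<Rightarrow> int" where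
  "double_lucas_balancing 0 = 2"
| "double_lucas_balancing (Suc 0) = 6"
| "double_lucas_balancing (Suc (Suc n)) =
     6 * double_lucas_balancing (Suc n) - double_lucas_balancing n"

end

theory Submission
  imports Defs
begin

text \<open>Both sequences satisfy the same recurrence, and it alone makes
  \<open>n * u (n + 1) - (n + 1) * u n\<close> grow by \<open>4 * (n + 1) * u (n + 1)\<close> from
  \<open>n\<close> to \<open>n + 1\<close>, so the sum telescopes. The initial values enter only
  through the constant \<open>u 0\<close>.\<close>

lemma sum_weighted_recurrence:
  fixes u :: "nat \<Rightarrow> 'a::comm_ring_1"
  assumes rec: "\<And>n. u (Suc (Suc n)) = 6 * u (Suc n) - u n"
  shows "4 * (\<Sum>i=1..n. of_nat i * u i) = of_nat n * u (n + 1) - of_nat (n + 1) * u n + u 0"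
proof (induction n)
  case 0
  show ?case by simp
next
  case (Suc n)
  \<comment> \<open>After \<open>rec\<close> the coefficient of \<open>u (Suc n)\<close> is
    \<open>6(n+1) - (n+2) = 4(n+1) + n\<close>; the terms in \<open>u n\<close> agree.\<close>
  then show ?case by (simp add: rec algebra_simps)
qed

theorem theorem5p6:
  fixes n :: nat
  assumes "n \<ge> 1"
  shows "(\<Sum>i=1..n. rat_of_nat i * rat_of_int (balancing i)) =
           1 / 4 * (rat_of_nat n * rat_of_int (balancing (n + 1))
                    - rat_of_nat (n + 1) * rat_of_int (balancing n))
       \<and> (\<Sum>i=1..n. rat_of_nat i * rat_of_int (double_lucas_balancing i)) =
           1 / 4 * (rat_of_nat n * rat_of_int (double_lucas_balancing (n + 1))
                    - rat_of_nat (n + 1) * rat_of_int (double_lucas_balancing n) + 2)"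
  \<comment> \<open>The constant \<open>u 0\<close> is 0 for balancing numbers and 2 for the double
    Lucas ones. Working over the rationals allows the division by 4.\<close>
  using sum_weighted_recurrence[of "\<lambda>i. rat_of_int (balancing i)" n]
    sum_weighted_recurrence[of "\<lambda>i. rat_of_int (double_lucas_balancing i)" n]
  by simp

end
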